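(* Let $n\geq 2$ be an integer. For $x\in\{2,\ldots,n\}$ write $n-x=a(x-1)+r$ with $a\in\mathbb{N}_0$ and $0\leq r<x-1$ (division with remainder), and call $x$ feasible if $x\geq a$ when $r=0$ and $x\geq a+1$ when $r\neq 0$. Then $$\min\left\{\|\lambda\|_2^2 : \lambda\in\mathcal{P}(n),\ \operatorname{rank}(\lambda)\geq 0\right\} = \min\left\{x^{2}+r(a+1)^{2}+(x-1-r)a^{2} : x\in\{2,\ldots,n\} \text{ feasible}\right\},$$ that is, the problem of minimizing $\|\lambda\|_2^2$ over partitions of $n$ of nonnegative rank is equivalent to minimizing $x^{2}+r(a+1)^{2}+(x-1-r)a^{2}$ over feasible $x$.
   Context: $\mathcal{P}(n)$ denotes the set of partitions of $n$, i.e., nonincreasing finite sequences $\lambda=(\lambda_1,\ldots,\lambda_k)$ of positive integers with sum $n$. For such $\lambda$, $\|\lambda\|_2^2=\sum_i \lambda_i^2$, and the rank of $\lambda$ is $\operatorname{rank}(\lambda)=\lambda_1-k$ (largest part minus number of parts). $\mathbb{N}_0$ is the set of nonnegative integers. *)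

theory Defs
  imports Main
begin

definition partitions :: "nat \<Rightarrow> nat list set" where
  "partitions n = {l. sorted_wrt (\<ge>) l \<and> (\<forall>p\<in>set l. p > 0) \<and> sum_list l = n}"

definition sq_norm :: "nat list \<Rightarrow> nat" where
  "sq_norm l = (\<Sum>p\<leftarrow>l. p\<^sup>2)"

(* The parts are nonincreasing, so the head is the largest part. The value on the
   empty partition (only possible for n = 0) is unspecified. *)
definition rank :: "nat list \<Rightarrow> int" where
  "rank l = int (hd l) - int (length l)"

(* n - x = quo n x * (x - 1) + rmd n x  with  rmd n x < x - 1,  for 2 <= x <= n;
   see quo_rmd_iff below. *)
definition quo :: "nat \<Rightarrow> nat \<Rightarrow> nat" where
  "quo n x = (n - x) div (x - 1)"

definition rmd :: "nat \<Rightarrow> nat \<Rightarrow> nat" where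
  "rmd n x = (n - x) mod (x - 1)"

definition feasible :: "nat \<Rightarrow> nat \<Rightarrow> bool" where
  "feasible n x \<longleftrightarrow>
     (rmd n x = 0 \<longrightarrow> x \<ge> quo n x) \<and> (rmd n x \<noteq> 0 \<longrightarrow> x \<ge> quo n x + 1)"

(* The subtractions do not truncate for x >= 2, since then rmd n x < x - 1. *)
definition objective :: "nat \<Rightarrow> nat \<Rightarrow> nat" where
  "objective n x =
     x\<^sup>2 + rmd n x * (quo n x + 1)\<^sup>2 + (x - 1 - rmd n x) * (quo n x)\<^sup>2"

lemma quo_rmd_iff:
  assumes "2 \<le> x"
  shows "n - x = a * (x - 1) + r \<and> r < x - 1 \<longleftrightarrow> a = quo n x \<and> r = rmd n x"
  using assms by (auto simp: quo_def rmd_def div_mult_mod_eq)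

(* Both minima are taken over finite nonempty sets, so Min is a genuine minimum. *)

lemma finite_partitions: "finite (partitions n)"
proof (rule finite_subset)
  show "partitions n \<subseteq> {l. set l \<subseteq> {..n} \<and> length l \<le> n}"
  proof
    fix l assume l: "l \<in> partitions n"
    have "length l \<le> sum_list l" if "\<forall>p\<in>set l. p > 0" for l :: "nat list"
      using that by (induction l) auto
    with l show "l \<in> {l. set l \<subseteq> {..n} \<and> length l \<le> n}"
      by (auto simp: partitions_def member_le_sum_list)
  qed
qed (rule finite_lists_length_le, simp)

lemma nonneg_rank_partition_exists:
  "n \<ge> 2 \<Longrightarrow> {l \<in> partitions n. rank l \<ge> 0} \<noteq> {}"
  by (auto simp: partitions_def rank_def intro!: exI[of _ "[n]"])

lemma feasible_exists: "n \<ge> 2 \<Longrightarrow> {x \<in> {2..n}. feasible n x} \<noteq> {}"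
  by (auto simp: feasible_def quo_def rmd_def intro!: exI[of _ n])

end

(* For a partition x # t of nonnegative rank, padding t with zeros gives x - 1 numbers with
   sum n - x. Among such numbers the sum of squares is least when they are balanced, i.e. when
   each of them is quo n x or quo n x + 1, which gives objective n x. Feasibility of x says that
   the balanced numbers do not exceed x, so that they form a partition together with x. *)
theory Submission imports Defs begin

(* Sum of (p - a) * (p - (a + 1)) >= 0 over the entries p, rearranged to avoid subtraction. *)
lemma sq_norm_tangent_bound:
  "(2 * a + 1) * sum_list t \<le> sq_norm t + length t * (a * (a + 1))"
proof (induction t)
  case Nil
  show ?case by simp
next
  case (Cons p t)
  have "(2 * a + 1) * p \<le> p\<^sup>2 + a * (a + 1)"
  proof (cases "p \<le> a")
    case True
    then obtain d where "a = p + d" using le_Suc_ex by blast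
    then show ?thesis by (simp add: power2_eq_square algebra_simps)
  next
    case False
    then obtain d where "p = a + 1 + d" by (metis le_Suc_ex not_less_eq_eq Suc_eq_plus1)
    then show ?thesis by (simp add: power2_eq_square algebra_simps)
  qed
  with Cons.IH show ?case by (simp add: sq_norm_def algebra_simps)
qed

text \<open>The tangent bound is an equality on entries \<open>a\<close> and \<open>a + 1\<close>,
  so it yields the balanced value. Replacing \<open>length t\<close> by \<open>m\<close> amounts to
  padding with zeros, each adding \<open>a * (a + 1)\<close> \<ge> 0.\<close>

lemma balanced_sq_norm_le:
  assumes "length t \<le> m" "sum_list t = a * m + r" "r \<le> m"
  shows "r * (a + 1)\<^sup>2 + (m - r) * a\<^sup>2 \<le> sq_norm t"
proof -
  obtain s where s: "m = r + s" using assms(3) le_Suc_ex by blast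
  have "(2 * a + 1) * (a * m + r) \<le> sq_norm t + m * (a * (a + 1))"
    using sq_norm_tangent_bound[of a t] mult_le_mono1[OF assms(1), of "a * (a + 1)"]
    unfolding assms(2) by linarith
  \<comment> \<open>The left side of the claim is exactly
    \<open>(2 * a + 1) * (a * m + r) - m * (a * (a + 1))\<close>.\<close>
  then show ?thesis
    by (simp add: s power2_eq_square algebra_simps)
qed

lemma feasible_objective_attained:
  assumes "x \<in> {2..n}" "feasible n x"
  obtains l where "l \<in> partitions n" "rank l \<ge> 0" "sq_norm l = objective n x"
proof -
  define a r where "a = quo n x" and "r = rmd n x"
  have nx: "n - x = a * (x - 1) + r" and r: "r < x - 1"
    using quo_rmd_iff[of x n a r] assms(1) by (auto simp: a_def r_def)
  define s where "s = x - 1 - r"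
  have x: "x = Suc (r + s)" using r by (simp add: s_def)
  (* For a = 0 the zero entries of the balanced sequence have to be dropped. *)
  define l where "l = x # replicate r (a + 1) @ (if a = 0 then [] else replicate s a)"
  have n: "n = x + (a * (r + s) + r)" using nx assms(1) le_add_diff_inverse[of x n] by (simp add: x)
  \<comment> \<open>Feasibility is split by \<open>r\<close> because \<open>a + 1\<close> occurs
    among the entries only if \<open>r\<close> \<noteq> 0.\<close>
  have "a \<le> x" "r \<noteq> 0 \<Longrightarrow> a + 1 \<le> x"
    using assms(2) by (auto simp: feasible_def a_def r_def)
  moreover have "sorted_wrt (\<ge>) (replicate k c)" for k and c :: nat
    by (induction k) auto
  ultimately have "sorted_wrt (\<ge>) l"
    by (auto simp: l_def sorted_wrt_append simp del: replicate.simps)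
  moreover have "\<forall>p\<in>set l. p > 0" using x by (auto simp: l_def)
  moreover have "sum_list l = n"
    using n by (auto simp: l_def sum_list_replicate algebra_simps)
  ultimately have "l \<in> partitions n" by (simp add: partitions_def)
  moreover have "rank l \<ge> 0" by (simp add: rank_def l_def x)
  moreover have "sq_norm l = objective n x"
    by (simp add: objective_def sq_norm_def l_def sum_list_replicate s_def
        flip: a_def r_def)
  ultimately show ?thesis by (rule that)
qed

text \<open>The witness is the largest part of \<open>l\<close>. It is feasible because at most
  \<open>x - 1\<close> further parts, each at most \<open>x\<close>, sum to
  \<open>n - x\<close>.\<close>

lemma objective_le_sq_norm:
  assumes "n \<ge> 2" "l \<in> partitions n" "rank l \<ge> 0"
  obtains x where "x \<in> {2..n}" "feasible n x" "objective n x \<le> sq_norm l"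
proof -
  obtain x t where l: "l = x # t"
    using assms(1,2) by (cases l) (auto simp: partitions_def)
  have n: "n = x + sum_list t" and le_x: "\<forall>p\<in>set t. p \<le> x"
    using assms(2) by (auto simp: l partitions_def)
  have len: "Suc (length t) \<le> x"
    using assms(3) by (simp add: l rank_def)
  have "sum_list t \<le> length t * x"
    using le_x by (induction t) auto
  also have "\<dots> \<le> (x - 1) * x"
    using len by (intro mult_le_mono1) simp
  finally have sum_le: "sum_list t \<le> x * (x - 1)"
    by (simp add: mult.commute)
  \<comment> \<open>For \<open>x = 1\<close> the bound leaves nothing after the head, so
    \<open>n\<close> would be 1.\<close>
  have "x \<noteq> 1"
    using sum_le n assms(1) by (auto simp del: sum_list_eq_0_iff)
  then have x: "x \<in> {2..n}"
    using len n by auto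
  define a r where "a = quo n x" and "r = rmd n x"
  have sum: "sum_list t = a * (x - 1) + r" and r: "r < x - 1"
    using quo_rmd_iff[of x n a r] x n by (auto simp: a_def r_def)
  \<comment> \<open>Cancelling \<open>x - 1\<close> > 0 gives feasibility; a nonzero remainder makes
    the inequality strict.\<close>
  have "a * (x - 1) \<le> x * (x - 1)"
    using sum_le sum by linarith
  then have "a \<le> x"
    using r by simp
  moreover have "a < x" if "r \<noteq> 0"
  proof -
    have "a * (x - 1) < x * (x - 1)"
      using sum_le sum that by linarith
    then show ?thesis by simp
  qed
  ultimately have "feasible n x"
    by (auto simp: feasible_def simp flip: a_def r_def)
  moreover have "objective n x \<le> sq_norm l"
    using balanced_sq_norm_le[of t "x - 1" a r] len sum r
    by (simp add: objective_def l sq_norm_def flip: a_def r_def)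
  ultimately show ?thesis using that x by blast
qed

theorem theorem2:
  fixes n :: nat
  assumes "n \<ge> 2"
  shows "Min {sq_norm l | l. l \<in> partitions n \<and> rank l \<ge> 0}
       = Min {objective n x | x. x \<in> {2..n} \<and> feasible n x}"
    (is "Min ?L = Min ?R")
proof (rule antisym)
  have finL: "finite ?L" and finR: "finite ?R"
    using finite_partitions[of n] by auto
  have neL: "?L \<noteq> {}" and neR: "?R \<noteq> {}"
    using nonneg_rank_partition_exists[OF assms] feasible_exists[OF assms] by auto
  have "?R \<subseteq> ?L"
    by (auto, metis atLeastAtMost_iff feasible_objective_attained)
  then show "Min ?L \<le> Min ?R"
    using finL neR by (intro Min_antimono)
  \<comment> \<open>A norm need not be an objective value; it suffices that it dominates
    one.\<close>
  show "Min ?R \<le> Min ?L"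
  proof (rule Min.boundedI[OF finL neL])
    fix v assume "v \<in> ?L"
    then obtain x where "x \<in> {2..n}" "feasible n x" "objective n x \<le> v"
      using objective_le_sq_norm[OF assms] by blast
    then show "Min ?R \<le> v"
      using finR Min_le[of ?R "objective n x"] by (blast intro: order_trans)
  qed
qed

end
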